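(* Let $\mathscr{A}=(\{\mathcal{A}_{s,t}\}_{0<s<t},\{\Delta_{r,s,t}\}_{0<r<s<t})$ be a unital $C^*$-subproduct system with unit $\{p_{s,t}\}_{0<s<t}$. If the $C^*$-algebra $C^*_{\{p_{s,t}\}}(\mathscr{A})$ admits an idempotent state $\varphi$, then $\mathscr{A}$ is co-unital and the family $\{\varphi_{s,t}\}_{0<s<t}$ of marginal states $$\varphi_{s,t}=\varphi\circ\Delta^\times_{s,t},\qquad 0<s<t,$$ is a co-unit of $\mathscr{A}$.
   Context: All tensor products of $C^*$-algebras are injective (minimal) tensor products; $\mathrm{id}$ denotes identity maps; a $*$-monomorphism is an injective $*$-homomorphism. A $C^*$-subproduct system is a pair $\mathscr{A}=(\{\mathcal{A}_{s,t}\}_{0<s<t},\{\Delta_{r,s,t}\}_{0<r<s<t})$ of $C^*$-algebras $\mathcal{A}_{s,t}$ and $*$-monomorphisms $\Delta_{r,s,t}:\mathcal{A}_{r,t}\to\mathcal{A}_{r,s}\otimes\mathcal{A}_{s,t}$ such that $(\mathrm{id}_{\mathcal{A}_{r,s}}\otimes\Delta_{s,t,u})\Delta_{r,s,u}=(\Delta_{r,s,t}\otimes\mathrm{id}_{\mathcal{A}_{t,u}})\Delta_{r,t,u}$ for all $0<r<s<t<u$. A unit of $\mathscr{A}$ is a family of non-zero projections $p_{s,t}\in\mathcal{A}_{s,t}$, $0<s<t$, with $\Delta_{r,s,t}(p_{r,t})=p_{r,s}\otimes p_{s,t}$ for all $0<r<s<t$. A co-unit of $\mathscr{A}$ is a family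 of states $\varphi_{s,t}$ of $\mathcal{A}_{s,t}$, $0<s<t$, with $\varphi_{r,t}=(\varphi_{r,s}\otimes\varphi_{s,t})\circ\Delta_{r,s,t}$ for all $0<r<s<t$. $\mathscr{A}$ is unital (co-unital) if it admits a unit (co-unit). For $0<s<t$, $\mathcal{P}_{s,t}$ is the set of finite partitions $I=\{s=\iota_0<\iota_1<\dots<\iota_m<\iota_{m+1}=t\}$ of $[s,t]$ ($m\ge 0$). Put $\mathcal{A}_I=\mathcal{A}_{\iota_0,\iota_1}\otimes\cdots\otimes\mathcal{A}_{\iota_m,\iota_{m+1}}$ and $p_I=p_{\iota_0,\iota_1}\otimes\cdots\otimes p_{\iota_m,\iota_{m+1}}$. Define $\Delta_{\{s,t\},I}:\mathcal{A}_{s,t}\to\mathcal{A}_I$ as the identity if $m=0$, as $\Delta_{\iota_0,\iota_1,\iota_2}$ if $m=1$, and as $(\Delta_{\{\iota_0,\iota_m\},I\setminus\{\iota_{m+1}\}}\otimes\mathrm{id}_{\mathcal{A}_{\iota_m,\iota_{m+1}}})\Delta_{\iota_0,\iota_m,\iota_{m+1}}$ if $m\ge2$. For $I\subseteq J$ in $\mathcal{P}_{s,t}$, with $I_i=J\cap[\iota_i,\iota_{i+1}]$, put $\Delta_{I,J}=\Delta_{\{\iota_0,\iota_1\},I_0}\otimes\cdots\otimes\Delta_{\{\iota_m,\iota_{m+1}\},I_m}:\mathcal{A}_I\to\mathcal{A}_J=\mathcal{A}_{I_0}\otimes\cdots\otimes\mathcal{A}_{I_m}$. $\mathcal{P}=\bigcup_{0<s<t}\mathcal{P}_{s,t}$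 is the set of all finite subsets of $(0,\infty)$ with at least two elements, ordered by inclusion. For $I\subseteq J$ in $\mathcal{P}$ with $I\in\mathcal{P}_{s,t}$, write $J=\underline{I}\cup I^\times\cup\overline{I}$, where $\underline{I}=\{j\in J: j\le s\}$, $I^\times=J\cap[s,t]$, $\overline{I}=\{j\in J: j\ge t\}$, so that $\mathcal{A}_J=\mathcal{A}_{\underline{I}}\otimes\mathcal{A}_{I^\times}\otimes\mathcal{A}_{\overline{I}}$, and define $\Delta^\times_{I,J}(x)=p_{\underline{I}}\otimes\Delta_{I,I^\times}(x)\otimes p_{\overline{I}}$ for $x\in\mathcal{A}_I$; tensor factors corresponding to single-point $\underline{I}$ or $\overline{I}$ are omitted (so $\Delta^\times_{I,J}=\Delta_{I,J}$ if $I,J\in\mathcal{P}_{s,t}$). These form an inductive system over $(\mathcal{P},\subseteq)$; $C^*_{\{p_{s,t}\}}(\mathscr{A})$ is its $C^*$-inductive limit, with connecting $*$-monomorphisms $\Delta^\times_I:\mathcal{A}_I\to C^*_{\{p_{s,t}\}}(\mathscr{A})$; write $\Delta^\times_{s,t}=\Delta^\times_{\{s,t\}}$. The one-parameter co-multiplication of $C^*_{\{p_{s,t}\}}(\mathscr{A})$ is the family $\{\Delta_s\}_{s>0}$ of $*$-monomorphisms $\Delta_s:C^*_{\{p_{s,t}\}}(\mathscr{A})\to C^*_{\{p_{s,t}\}}(\mathscr{A})\otimes C^*_{\{p_{s,t}\}}(\mathscr{A})$ determined by $\Delta_s\Delta^\times_{I\cup J}=\Delta^\times_I\otimes\Delta^\times_J$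 for all $I\in\mathcal{P}_{r,s}$, $J\in\mathcal{P}_{s,t}$, $0<r<s<t$. The projection $p=\Delta^\times_{s,t}(p_{s,t})$ does not depend on $0<s<t$. A state $\varphi$ of $C^*_{\{p_{s,t}\}}(\mathscr{A})$ is an idempotent state if $(\varphi\otimes\varphi)\circ\Delta_s=\varphi$ for all $s>0$ and $p\notin\mathcal{N}_\varphi$, where $\mathcal{N}_\varphi=\{x:\varphi(x^*x)=0\}$ is the left kernel of $\varphi$. *)

theory Defs
  imports Complex_Main "HOL-Algebra.Module"
begin

section \<open>C*-algebras\<close>

definition complex_field :: "complex ring" where
  "complex_field = \<lparr>carrier = UNIV, mult = (*), one = 1, zero = 0, add = (+)\<rparr>"

text \<open>C*-algebras are carrier-based so that a family of different algebras can be indexed by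
  reals or by finite sets.  They need not be unital: the field \<open>one\<close> inherited from
  \<open>module\<close> is never used.\<close>

record 'a cstar = "(complex, 'a) module" +
  star :: "'a \<Rightarrow> 'a"
  cnorm :: "'a \<Rightarrow> real"

locale star_algebra = module complex_field A for A :: "'a cstar" (structure) +
  assumes mult_closed: "\<lbrakk>x \<in> carrier A; y \<in> carrier A\<rbrakk> \<Longrightarrow> x \<otimes> y \<in> carrier A"
    and mult_assoc: "\<lbrakk>x \<in> carrier A; y \<in> carrier A; z \<in> carrier A\<rbrakk>
      \<Longrightarrow> (x \<otimes> y) \<otimes> z = x \<otimes> (y \<otimes> z)"
    and distrib_left: "\<lbrakk>x \<in> carrier A; y \<in> carrier A; z \<in> carrier A\<rbrakk>
      \<Longrightarrow> x \<otimes> (y \<oplus> z) = (x \<otimes> y) \<oplus> (x \<otimes> z)"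
    and distrib_right: "\<lbrakk>x \<in> carrier A; y \<in> carrier A; z \<in> carrier A\<rbrakk>
      \<Longrightarrow> (x \<oplus> y) \<otimes> z = (x \<otimes> z) \<oplus> (y \<otimes> z)"
    and smult_mult_left: "\<lbrakk>x \<in> carrier A; y \<in> carrier A\<rbrakk>
      \<Longrightarrow> (c \<odot> x) \<otimes> y = c \<odot> (x \<otimes> y)"
    and smult_mult_right: "\<lbrakk>x \<in> carrier A; y \<in> carrier A\<rbrakk>
      \<Longrightarrow> x \<otimes> (c \<odot> y) = c \<odot> (x \<otimes> y)"
    and star_closed: "x \<in> carrier A \<Longrightarrow> star A x \<in> carrier A"
    and star_star: "x \<in> carrier A \<Longrightarrow> star A (star A x) = x"
    and star_add: "\<lbrakk>x \<in> carrier A; y \<in> carrier A\<rbrakk>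
      \<Longrightarrow> star A (x \<oplus> y) = star A x \<oplus> star A y"
    and star_smult: "x \<in> carrier A \<Longrightarrow> star A (c \<odot> x) = cnj c \<odot> star A x"
    and star_mult: "\<lbrakk>x \<in> carrier A; y \<in> carrier A\<rbrakk>
      \<Longrightarrow> star A (x \<otimes> y) = star A y \<otimes> star A x"

text \<open>C*-norms on the *-algebra \<open>A\<close>; the field \<open>cnorm A\<close> plays no role here.\<close>

definition cstar_norm :: "'a cstar \<Rightarrow> ('a \<Rightarrow> real) \<Rightarrow> bool" where
  "cstar_norm A \<gamma> \<longleftrightarrow>
     (\<forall>x\<in>carrier A. 0 \<le> \<gamma> x \<and> (\<gamma> x = 0 \<longleftrightarrow> x = \<zero>\<^bsub>A\<^esub>)) \<and>
     (\<forall>x\<in>carrier A. \<forall>c. \<gamma> (c \<odot>\<^bsub>A\<^esub> x) = cmod c * \<gamma> x) \<and>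
     (\<forall>x\<in>carrier A. \<forall>y\<in>carrier A. \<gamma> (x \<oplus>\<^bsub>A\<^esub> y) \<le> \<gamma> x + \<gamma> y) \<and>
     (\<forall>x\<in>carrier A. \<forall>y\<in>carrier A. \<gamma> (x \<otimes>\<^bsub>A\<^esub> y) \<le> \<gamma> x * \<gamma> y) \<and>
     (\<forall>x\<in>carrier A. \<gamma> (star A x \<otimes>\<^bsub>A\<^esub> x) = (\<gamma> x)\<^sup>2)"

locale cstar_algebra = star_algebra +
  assumes cstar_norm: "cstar_norm A (cnorm A)"
    and complete:
      "\<lbrakk>\<And>n::nat. X n \<in> carrier A;
        \<And>e. e > 0 \<Longrightarrow> \<exists>N. \<forall>m\<ge>N. \<forall>n\<ge>N. cnorm A (X m \<ominus> X n) < e\<rbrakk>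
       \<Longrightarrow> \<exists>x\<in>carrier A. (\<lambda>n. cnorm A (X n \<ominus> x)) \<longlonglongrightarrow> 0"

definition norm_dense :: "'a cstar \<Rightarrow> 'a set \<Rightarrow> bool" where
  "norm_dense A D \<longleftrightarrow> D \<subseteq> carrier A \<and>
     (\<forall>x\<in>carrier A. \<forall>e>0. \<exists>z\<in>D. cnorm A (x \<ominus>\<^bsub>A\<^esub> z) < e)"

text \<open>All maps are only meaningful on the carrier of their domain.\<close>

definition star_hom :: "'a cstar \<Rightarrow> 'b cstar \<Rightarrow> ('a \<Rightarrow> 'b) \<Rightarrow> bool" where
  "star_hom A B f \<longleftrightarrow>
     f \<in> carrier A \<rightarrow> carrier B \<and>
     (\<forall>x\<in>carrier A. \<forall>y\<in>carrier A. f (x \<oplus>\<^bsub>A\<^esub> y) = f x \<oplus>\<^bsub>B\<^esub> f y) \<and>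
     (\<forall>x\<in>carrier A. \<forall>c. f (c \<odot>\<^bsub>A\<^esub> x) = c \<odot>\<^bsub>B\<^esub> f x) \<and>
     (\<forall>x\<in>carrier A. \<forall>y\<in>carrier A. f (x \<otimes>\<^bsub>A\<^esub> y) = f x \<otimes>\<^bsub>B\<^esub> f y) \<and>
     (\<forall>x\<in>carrier A. f (star A x) = star B (f x))"

definition star_mono :: "'a cstar \<Rightarrow> 'b cstar \<Rightarrow> ('a \<Rightarrow> 'b) \<Rightarrow> bool" where
  "star_mono A B f \<longleftrightarrow> star_hom A B f \<and> inj_on f (carrier A)"

definition projection :: "'a cstar \<Rightarrow> 'a \<Rightarrow> bool" where
  "projection A p \<longleftrightarrow> p \<in> carrier A \<and> p \<otimes>\<^bsub>A\<^esub> p = p \<and> star A p = p"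

definition bounded_functional :: "'a cstar \<Rightarrow> ('a \<Rightarrow> complex) \<Rightarrow> bool" where
  "bounded_functional A f \<longleftrightarrow>
     (\<forall>x\<in>carrier A. \<forall>y\<in>carrier A. f (x \<oplus>\<^bsub>A\<^esub> y) = f x + f y) \<and>
     (\<forall>x\<in>carrier A. \<forall>c. f (c \<odot>\<^bsub>A\<^esub> x) = c * f x) \<and>
     (\<exists>K. \<forall>x\<in>carrier A. cmod (f x) \<le> K * cnorm A x)"

definition functional_norm :: "'a cstar \<Rightarrow> ('a \<Rightarrow> complex) \<Rightarrow> real" where
  "functional_norm A f = (SUP x \<in> {x \<in> carrier A. cnorm A x \<le> 1}. cmod (f x))"

definition state :: "'a cstar \<Rightarrow> ('a \<Rightarrow> complex) \<Rightarrow> bool" where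
  "state A f \<longleftrightarrow> bounded_functional A f \<and>
     (\<forall>x\<in>carrier A. f (star A x \<otimes>\<^bsub>A\<^esub> x) \<in> \<real> \<and> 0 \<le> Re (f (star A x \<otimes>\<^bsub>A\<^esub> x))) \<and>
     functional_norm A f = 1"

definition left_kernel :: "'a cstar \<Rightarrow> ('a \<Rightarrow> complex) \<Rightarrow> 'a set" where
  "left_kernel A f = {x \<in> carrier A. f (star A x \<otimes>\<^bsub>A\<^esub> x) = 0}"


section \<open>Minimal tensor products\<close>

definition algebraic_tensors ::
  "'a cstar \<Rightarrow> 'b cstar \<Rightarrow> 'c cstar \<Rightarrow> ('a \<Rightarrow> 'b \<Rightarrow> 'c) \<Rightarrow> 'c set" where
  "algebraic_tensors A B T \<tau> =
     {finsum T (\<lambda>i. \<tau> (a i) (b i)) {..<n} | a b (n::nat).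
        a \<in> {..<n} \<rightarrow> carrier A \<and> b \<in> {..<n} \<rightarrow> carrier B}"

text \<open>\<open>(T, \<tau>)\<close> is a realisation of the minimal tensor product of \<open>A\<close> and \<open>B\<close>,
  with \<open>\<tau> a b\<close> the elementary tensor of \<open>a\<close> and \<open>b\<close>: the algebraic tensor product
  embeds as a dense *-subalgebra (the condition on linearly independent \<open>b i\<close> is injectivity
  of the canonical linear map from it to \<open>T\<close>), and the norm of \<open>T\<close> is the least C*-norm
  on it.  This determines \<open>T\<close> up to a unique *-isomorphism respecting elementary tensors.\<close>

definition min_tensor ::
  "'a cstar \<Rightarrow> 'b cstar \<Rightarrow> 'c cstar \<Rightarrow> ('a \<Rightarrow> 'b \<Rightarrow> 'c) \<Rightarrow> bool" where
  "min_tensor A B T \<tau> \<longleftrightarrow>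
     cstar_algebra A \<and> cstar_algebra B \<and> cstar_algebra T \<and>
     (\<forall>a\<in>carrier A. \<forall>b\<in>carrier B. \<tau> a b \<in> carrier T) \<and>
     (\<forall>a\<in>carrier A. \<forall>a'\<in>carrier A. \<forall>b\<in>carrier B. \<tau> (a \<oplus>\<^bsub>A\<^esub> a') b = \<tau> a b \<oplus>\<^bsub>T\<^esub> \<tau> a' b) \<and>
     (\<forall>a\<in>carrier A. \<forall>b\<in>carrier B. \<forall>b'\<in>carrier B. \<tau> a (b \<oplus>\<^bsub>B\<^esub> b') = \<tau> a b \<oplus>\<^bsub>T\<^esub> \<tau> a b') \<and>
     (\<forall>a\<in>carrier A. \<forall>b\<in>carrier B. \<forall>c. \<tau> (c \<odot>\<^bsub>A\<^esub> a) b = c \<odot>\<^bsub>T\<^esub> \<tau> a b \<and>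
        \<tau> a (c \<odot>\<^bsub>B\<^esub> b) = c \<odot>\<^bsub>T\<^esub> \<tau> a b) \<and>
     (\<forall>a\<in>carrier A. \<forall>a'\<in>carrier A. \<forall>b\<in>carrier B. \<forall>b'\<in>carrier B.
        \<tau> a b \<otimes>\<^bsub>T\<^esub> \<tau> a' b' = \<tau> (a \<otimes>\<^bsub>A\<^esub> a') (b \<otimes>\<^bsub>B\<^esub> b')) \<and>
     (\<forall>a\<in>carrier A. \<forall>b\<in>carrier B. star T (\<tau> a b) = \<tau> (star A a) (star B b)) \<and>
     (\<forall>(n::nat) a b. a \<in> {..<n} \<rightarrow> carrier A \<and> b \<in> {..<n} \<rightarrow> carrier B \<and>
        (\<forall>c. finsum B (\<lambda>i. c i \<odot>\<^bsub>B\<^esub> b i) {..<n} = \<zero>\<^bsub>B\<^esub> \<longrightarrow> (\<forall>i<n. c i = 0)) \<and>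
        finsum T (\<lambda>i. \<tau> (a i) (b i)) {..<n} = \<zero>\<^bsub>T\<^esub> \<longrightarrow> (\<forall>i<n. a i = \<zero>\<^bsub>A\<^esub>)) \<and>
     norm_dense T (algebraic_tensors A B T \<tau>) \<and>
     (\<forall>\<gamma>. cstar_norm (T\<lparr>carrier := algebraic_tensors A B T \<tau>\<rparr>) \<gamma> \<longrightarrow>
        (\<forall>z\<in>algebraic_tensors A B T \<tau>. cnorm T z \<le> \<gamma> z))"

text \<open>\<open>h\<close> is the tensor product of the *-homomorphisms \<open>f\<close> and \<open>g\<close>, from
  \<open>(T, \<tau>)\<close> (a tensor product of \<open>A\<close> and \<open>B\<close>) to \<open>(T', \<tau>')\<close>.  Such an \<open>h\<close> exists
  and is unique on \<open>carrier T\<close>.\<close>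

definition is_tensor_hom ::
  "'a cstar \<Rightarrow> 'b cstar \<Rightarrow> 'c cstar \<Rightarrow> ('a \<Rightarrow> 'b \<Rightarrow> 'c) \<Rightarrow> 'f cstar \<Rightarrow> ('d \<Rightarrow> 'e \<Rightarrow> 'f) \<Rightarrow>
   ('a \<Rightarrow> 'd) \<Rightarrow> ('b \<Rightarrow> 'e) \<Rightarrow> ('c \<Rightarrow> 'f) \<Rightarrow> bool" where
  "is_tensor_hom A B T \<tau> T' \<tau>' f g h \<longleftrightarrow> star_hom T T' h \<and>
     (\<forall>a\<in>carrier A. \<forall>b\<in>carrier B. h (\<tau> a b) = \<tau>' (f a) (g b))"

definition tensor_hom ::
  "'a cstar \<Rightarrow> 'b cstar \<Rightarrow> 'c cstar \<Rightarrow> ('a \<Rightarrow> 'b \<Rightarrow> 'c) \<Rightarrow> 'f cstar \<Rightarrow> ('d \<Rightarrow> 'e \<Rightarrow> 'f) \<Rightarrow>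
   ('a \<Rightarrow> 'd) \<Rightarrow> ('b \<Rightarrow> 'e) \<Rightarrow> ('c \<Rightarrow> 'f)" where
  "tensor_hom A B T \<tau> T' \<tau>' f g = (SOME h. is_tensor_hom A B T \<tau> T' \<tau>' f g h)"

text \<open>\<open>F\<close> is the tensor product of the functionals \<open>\<phi>\<close> and \<open>\<psi>\<close>, i.e. the unique
  bounded functional on \<open>T\<close> that is multiplicative on elementary tensors.\<close>

definition is_tensor_functional ::
  "'a cstar \<Rightarrow> 'b cstar \<Rightarrow> 'c cstar \<Rightarrow> ('a \<Rightarrow> 'b \<Rightarrow> 'c) \<Rightarrow>
   ('a \<Rightarrow> complex) \<Rightarrow> ('b \<Rightarrow> complex) \<Rightarrow> ('c \<Rightarrow> complex) \<Rightarrow> bool" where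
  "is_tensor_functional A B T \<tau> \<phi> \<psi> F \<longleftrightarrow> bounded_functional T F \<and>
     (\<forall>a\<in>carrier A. \<forall>b\<in>carrier B. F (\<tau> a b) = \<phi> a * \<psi> b)"


section \<open>C*-subproduct systems\<close>

text \<open>Finite subsets of the open half-line with at least two points, and those with
  minimum \<open>s\<close> and maximum \<open>t\<close>, i.e. the partitions of \<open>[s,t]\<close>.\<close>

definition parts :: "real set set" where
  "parts = {I. finite I \<and> I \<subseteq> {0<..} \<and> 2 \<le> card I}"

definition parts_of :: "real \<Rightarrow> real \<Rightarrow> real set set" where
  "parts_of s t = {I \<in> parts. Min I = s \<and> Max I = t}"

text \<open>For \<open>I = {\<iota>\<^sub>0 < \<dots> < \<iota>\<^sub>n}\<close>, \<open>alg S I\<close> is the tensor product of the algebras attached to the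
  consecutive pairs in \<open>I\<close>; in particular \<open>alg S {s,t}\<close> is the algebra with index \<open>s,t\<close>.
  For \<open>Max I = Min J\<close>, \<open>tens S I J\<close> is the canonical map from
  \<open>alg S I \<times> alg S J\<close> to \<open>alg S (I \<union> J)\<close> (concatenation of tensors).  All algebras
  live on one type, which is no restriction because they form a set-indexed family and can be
  relabelled inside a large enough type.\<close>

record 'a subproduct =
  alg :: "real set \<Rightarrow> 'a cstar"
  tens :: "real set \<Rightarrow> real set \<Rightarrow> 'a \<Rightarrow> 'a \<Rightarrow> 'a"
  comult :: "real \<Rightarrow> real \<Rightarrow> real \<Rightarrow> 'a \<Rightarrow> 'a"

text \<open>The associativity clause makes the identification of \<open>(A \<otimes> B) \<otimes> C\<close> with
  \<open>A \<otimes> (B \<otimes> C)\<close> strict, so that every \<open>alg S I\<close> is an iterated minimal tensor product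
  independently of the bracketing.\<close>

definition tensor_family :: "'a subproduct \<Rightarrow> bool" where
  "tensor_family S \<longleftrightarrow>
     (\<forall>I\<in>parts. \<forall>J\<in>parts. Max I = Min J \<longrightarrow>
        min_tensor (alg S I) (alg S J) (alg S (I \<union> J)) (tens S I J)) \<and>
     (\<forall>I\<in>parts. \<forall>J\<in>parts. \<forall>K\<in>parts. Max I = Min J \<longrightarrow> Max J = Min K \<longrightarrow>
        (\<forall>x\<in>carrier (alg S I). \<forall>y\<in>carrier (alg S J). \<forall>z\<in>carrier (alg S K).
           tens S (I \<union> J) K (tens S I J x y) z = tens S I (J \<union> K) x (tens S J K y z)))"

text \<open>The tensor product of \<open>f : alg S I \<rightarrow> alg S I'\<close> and \<open>g : alg S J \<rightarrow> alg S J'\<close>.\<close>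

definition fam_hom ::
  "'a subproduct \<Rightarrow> real set \<Rightarrow> real set \<Rightarrow> real set \<Rightarrow> real set \<Rightarrow>
   ('a \<Rightarrow> 'a) \<Rightarrow> ('a \<Rightarrow> 'a) \<Rightarrow> ('a \<Rightarrow> 'a)" where
  "fam_hom S I J I' J' f g =
     tensor_hom (alg S I) (alg S J) (alg S (I \<union> J)) (tens S I J)
       (alg S (I' \<union> J')) (tens S I' J') f g"

definition cstar_subproduct_system :: "'a subproduct \<Rightarrow> bool" where
  "cstar_subproduct_system S \<longleftrightarrow>
     (\<forall>s t. 0 < s \<and> s < t \<longrightarrow> cstar_algebra (alg S {s,t})) \<and>
     tensor_family S \<and>
     (\<forall>r s t. 0 < r \<and> r < s \<and> s < t \<longrightarrow>
        star_mono (alg S {r,t}) (alg S ({r,s} \<union> {s,t})) (comult S r s t)) \<and>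
     (\<forall>r s t u. 0 < r \<and> r < s \<and> s < t \<and> t < u \<longrightarrow>
        (\<forall>x\<in>carrier (alg S {r,u}).
           fam_hom S {r,s} {s,u} {r,s} {s,t,u} id (comult S s t u) (comult S r s u x) =
           fam_hom S {r,t} {t,u} {r,s,t} {t,u} (comult S r s t) id (comult S r t u x)))"

definition subproduct_unit :: "'a subproduct \<Rightarrow> (real \<Rightarrow> real \<Rightarrow> 'a) \<Rightarrow> bool" where
  "subproduct_unit S p \<longleftrightarrow>
     (\<forall>s t. 0 < s \<and> s < t \<longrightarrow>
        projection (alg S {s,t}) (p s t) \<and> p s t \<noteq> \<zero>\<^bsub>alg S {s,t}\<^esub>) \<and>
     (\<forall>r s t. 0 < r \<and> r < s \<and> s < t \<longrightarrow>
        comult S r s t (p r t) = tens S {r,s} {s,t} (p r s) (p s t))"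

definition subproduct_counit :: "'a subproduct \<Rightarrow> (real \<Rightarrow> real \<Rightarrow> 'a \<Rightarrow> complex) \<Rightarrow> bool" where
  "subproduct_counit S \<phi> \<longleftrightarrow>
     (\<forall>s t. 0 < s \<and> s < t \<longrightarrow> state (alg S {s,t}) (\<phi> s t)) \<and>
     (\<forall>r s t. 0 < r \<and> r < s \<and> s < t \<longrightarrow>
        (\<exists>F. is_tensor_functional (alg S {r,s}) (alg S {s,t})
               (alg S ({r,s} \<union> {s,t})) (tens S {r,s} {s,t}) (\<phi> r s) (\<phi> s t) F \<and>
             (\<forall>x\<in>carrier (alg S {r,t}). \<phi> r t x = F (comult S r s t x))))"

definition co_unital :: "'a subproduct \<Rightarrow> bool" where
  "co_unital S \<longleftrightarrow> (\<exists>\<phi>. subproduct_counit S \<phi>)"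


section \<open>The inductive system\<close>

text \<open>The map \<open>\<Delta>\<close> with indices \<open>{Min I, Max I}\<close> and \<open>I\<close>.\<close>

function delta_block :: "'a subproduct \<Rightarrow> real set \<Rightarrow> 'a \<Rightarrow> 'a" where
  "delta_block S I =
     (if card I \<le> 2 then id
      else let t = Max I; I' = I - {t}; s = Min I; q = Max I' in
        if card I = 3 then comult S s q t
        else fam_hom S {s,q} {q,t} I' {q,t} (delta_block S I') id \<circ> comult S s q t)"
  by auto
termination
proof (relation "measure (\<lambda>(S, I). card I)", goal_cases)
  case (2 S I t I')
  then have "finite I" "I \<noteq> {}" by (auto intro: card_ge_0_finite)
  with 2 show ?case by (auto intro!: psubset_card_mono simp: card_gt_0_iff)
qed simp

text \<open>The map \<open>\<Delta>\<close> with indices \<open>I \<subseteq> J\<close> having the same end points: the tensor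
  product of the block maps, split off from the right.\<close>

function delta :: "'a subproduct \<Rightarrow> real set \<Rightarrow> real set \<Rightarrow> 'a \<Rightarrow> 'a" where
  "delta S I J =
     (if card I \<le> 2 then delta_block S J
      else let t = Max I; I' = I - {t}; q = Max I' in
        fam_hom S I' {q,t} (J \<inter> {..q}) (J \<inter> {q..})
          (delta S I' (J \<inter> {..q})) (delta_block S (J \<inter> {q..})))"
  by auto
termination
proof (relation "measure (\<lambda>(S, I, J). card I)", goal_cases)
  case (2 S I J t I' q)
  then have "finite I" "I \<noteq> {}" by (auto intro: card_ge_0_finite)
  with 2 show ?case by (auto intro!: psubset_card_mono simp: card_gt_0_iff)
qed simp

declare delta_block.simps [simp del] delta.simps [simp del]

function unit_tensor :: "'a subproduct \<Rightarrow> (real \<Rightarrow> real \<Rightarrow> 'a) \<Rightarrow> real set \<Rightarrow> 'a" where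
  "unit_tensor S p I =
     (if card I \<le> 2 then p (Min I) (Max I)
      else let t = Max I; I' = I - {t}; q = Max I' in
        tens S I' {q,t} (unit_tensor S p I') (p q t))"
  by auto
termination
proof (relation "measure (\<lambda>(S, p, I). card I)", goal_cases)
  case (2 S p I t I')
  then have "finite I" "I \<noteq> {}" by (auto intro: card_ge_0_finite)
  with 2 show ?case by (auto intro!: psubset_card_mono simp: card_gt_0_iff)
qed simp

declare unit_tensor.simps [simp del]

text \<open>A one-point left or right part contributes no tensor factor.\<close>

definition delta_times ::
  "'a subproduct \<Rightarrow> (real \<Rightarrow> real \<Rightarrow> 'a) \<Rightarrow> real set \<Rightarrow> real set \<Rightarrow> 'a \<Rightarrow> 'a" where
  "delta_times S p I J x =
     (let s = Min I; t = Max I;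
          L = J \<inter> {..s}; M = J \<inter> {s..t}; R = J \<inter> {t..};
          y = delta S I M x;
          z = (if card L \<ge> 2 then tens S L M (unit_tensor S p L) y else y)
      in if card R \<ge> 2 then tens S (L \<union> M) R z (unit_tensor S p R) else z)"

text \<open>\<open>(C, \<iota>)\<close> is the C*-inductive limit over \<open>(Idx, \<subseteq>)\<close> of the algebras
  \<open>A I\<close> with connecting *-monomorphisms \<open>f I J\<close>.  As these are injective, hence isometric,
  the limit is the completion of the union of the \<open>A I\<close>, and the conditions below determine it up
  to a unique *-isomorphism compatible with the maps \<open>\<iota> I\<close>.\<close>

definition cstar_inductive_limit ::
  "'i set set \<Rightarrow> ('i set \<Rightarrow> 'a cstar) \<Rightarrow> ('i set \<Rightarrow> 'i set \<Rightarrow> 'a \<Rightarrow> 'a) \<Rightarrow>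
   'b cstar \<Rightarrow> ('i set \<Rightarrow> 'a \<Rightarrow> 'b) \<Rightarrow> bool" where
  "cstar_inductive_limit Idx A f C \<iota> \<longleftrightarrow>
     cstar_algebra C \<and>
     (\<forall>I\<in>Idx. star_mono (A I) C (\<iota> I)) \<and>
     (\<forall>I\<in>Idx. \<forall>J\<in>Idx. I \<subseteq> J \<longrightarrow> (\<forall>x\<in>carrier (A I). \<iota> J (f I J x) = \<iota> I x)) \<and>
     norm_dense C (\<Union>I\<in>Idx. \<iota> I ` carrier (A I))"

text \<open>\<open>C\<close> is the C*-algebra of \<open>S\<close> with respect to the unit \<open>p\<close>, and \<open>D I\<close> is the
  canonical embedding of \<open>alg S I\<close>.\<close>

definition subproduct_limit ::
  "'a subproduct \<Rightarrow> (real \<Rightarrow> real \<Rightarrow> 'a) \<Rightarrow> 'b cstar \<Rightarrow> (real set \<Rightarrow> 'a \<Rightarrow> 'b) \<Rightarrow> bool" where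
  "subproduct_limit S p C D \<longleftrightarrow> cstar_inductive_limit parts (alg S) (delta_times S p) C D"

text \<open>\<open>(CC, \<tau>)\<close> is the minimal tensor product of \<open>C\<close> with itself.\<close>

definition comultiplication ::
  "'a subproduct \<Rightarrow> 'b cstar \<Rightarrow> (real set \<Rightarrow> 'a \<Rightarrow> 'b) \<Rightarrow> 'c cstar \<Rightarrow> ('b \<Rightarrow> 'b \<Rightarrow> 'c) \<Rightarrow>
   (real \<Rightarrow> 'b \<Rightarrow> 'c) \<Rightarrow> bool" where
  "comultiplication S C D CC \<tau> \<Delta> \<longleftrightarrow>
     (\<forall>s>0. star_mono C CC (\<Delta> s)) \<and>
     (\<forall>r s t. 0 < r \<and> r < s \<and> s < t \<longrightarrow>
        (\<forall>I\<in>parts_of r s. \<forall>J\<in>parts_of s t.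
           is_tensor_hom (alg S I) (alg S J) (alg S (I \<union> J)) (tens S I J) CC \<tau> (D I) (D J)
             (\<Delta> s \<circ> D (I \<union> J))))"

definition limit_projection :: "(real \<Rightarrow> real \<Rightarrow> 'a) \<Rightarrow> (real set \<Rightarrow> 'a \<Rightarrow> 'b) \<Rightarrow> 'b" where
  "limit_projection p D = (THE q. \<forall>s t. 0 < s \<and> s < t \<longrightarrow> D {s,t} (p s t) = q)"

definition idempotent_state ::
  "(real \<Rightarrow> real \<Rightarrow> 'a) \<Rightarrow> 'b cstar \<Rightarrow> (real set \<Rightarrow> 'a \<Rightarrow> 'b) \<Rightarrow> 'c cstar \<Rightarrow> ('b \<Rightarrow> 'b \<Rightarrow> 'c) \<Rightarrow>
   (real \<Rightarrow> 'b \<Rightarrow> 'c) \<Rightarrow> ('b \<Rightarrow> complex) \<Rightarrow> bool" where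
  "idempotent_state p C D CC \<tau> \<Delta> \<phi> \<longleftrightarrow>
     state C \<phi> \<and>
     (\<exists>F. is_tensor_functional C C CC \<tau> \<phi> \<phi> F \<and>
          (\<forall>s>0. \<forall>x\<in>carrier C. F (\<Delta> s x) = \<phi> x)) \<and>
     limit_projection p D \<notin> left_kernel C \<phi>"

end

theory Submission
  imports Defs
begin

text \<open>Applying \<open>(\<phi> \<otimes> \<phi>) \<circ> \<Delta>\<^sub>s = \<phi>\<close> to \<open>p\<close>, whose image is \<open>p \<otimes> p\<close>, gives \<open>\<phi>(p)\<^sup>2 = \<phi>(p)\<close>,
  and \<open>\<phi>(p) \<noteq> 0\<close> since \<open>p\<close> is a projection outside the left kernel, so \<open>\<phi>(p) = 1\<close>.  Hence each
  marginal attains the value 1 at a projection of norm 1 and, as *-homomorphisms are contractive,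
  is a state.  The co-unit identity is idempotency restricted to the image of the algebra with
  index \<open>{r,s,t}\<close>.

  Contractivity is proved without spectral theory: for self-adjoint \<open>h\<close> with \<open>\<parallel>h\<parallel> < 1\<close> the
  elements \<open>h \<plusminus> \<i> d\<close>, where \<open>d = (1 - h\<^sup>2)\<^bsup>1/2\<^esup>\<close>, are unitary in the unitisation, and so are their
  images, whose mean is the image of \<open>h\<close>.\<close>

section \<open>Arithmetic in *-algebras\<close>

context star_algebra
begin

lemma smult_scalar_closed [simp]: "x \<in> carrier A \<Longrightarrow> c \<odot> x \<in> carrier A"
  by (rule smult_closed) (simp_all add: complex_field_def)

lemma smult_add_left: "x \<in> carrier A \<Longrightarrow> (c + d) \<odot> x = c \<odot> x \<oplus> d \<odot> x"
  using smult_l_distr[of c d x] by (simp add: complex_field_def)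

lemma smult_add_right: "x \<in> carrier A \<Longrightarrow> y \<in> carrier A \<Longrightarrow> c \<odot> (x \<oplus> y) = c \<odot> x \<oplus> c \<odot> y"
  using smult_r_distr[of c x y] by (simp add: complex_field_def)

lemma smult_smult: "x \<in> carrier A \<Longrightarrow> c \<odot> (d \<odot> x) = (c * d) \<odot> x"
  using smult_assoc1[of c d x] by (simp add: complex_field_def)

lemma smult_1 [simp]: "x \<in> carrier A \<Longrightarrow> 1 \<odot> x = x"
  using smult_one[of x] by (simp add: complex_field_def)

lemma smult_0 [simp]: "x \<in> carrier A \<Longrightarrow> 0 \<odot> x = \<zero>"
  using smult_l_null[of x] by (simp add: complex_field_def)

text \<open>Turns subtraction into addition of a scalar multiple, so that bilinearity and the rules
  for \<open>star\<close> extend to differences.\<close>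

lemma a_inv_eq_smult: assumes "x \<in> carrier A" shows "\<ominus> x = (-1) \<odot> x"
proof -
  have "x \<oplus> (-1) \<odot> x = \<zero>"
    using smult_add_left[OF assms, of 1 "-1"] assms by simp
  then show ?thesis
    using assms by (simp add: minus_equality a_comm)
qed

lemma minus_eq_smult: "x \<in> carrier A \<Longrightarrow> y \<in> carrier A \<Longrightarrow> x \<ominus> y = x \<oplus> (-1) \<odot> y"
  by (simp add: a_minus_def a_inv_eq_smult)

lemma smult_minus: "x \<in> carrier A \<Longrightarrow> y \<in> carrier A \<Longrightarrow> c \<odot> (x \<ominus> y) = c \<odot> x \<ominus> c \<odot> y"
  by (simp add: minus_eq_smult smult_add_right smult_smult)

lemma mult_diff_right:
  "x \<in> carrier A \<Longrightarrow> y \<in> carrier A \<Longrightarrow> z \<in> carrier A \<Longrightarrow> x \<otimes> (y \<ominus> z) = x \<otimes> y \<ominus> x \<otimes> z"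
  by (simp add: minus_eq_smult distrib_left smult_mult_right mult_closed)

lemma mult_diff_left:
  "x \<in> carrier A \<Longrightarrow> y \<in> carrier A \<Longrightarrow> z \<in> carrier A \<Longrightarrow> (x \<ominus> y) \<otimes> z = x \<otimes> z \<ominus> y \<otimes> z"
  by (simp add: minus_eq_smult distrib_right smult_mult_left mult_closed)

lemma star_minus: "x \<in> carrier A \<Longrightarrow> y \<in> carrier A \<Longrightarrow> star A (x \<ominus> y) = star A x \<ominus> star A y"
  by (simp add: minus_eq_smult star_add star_smult star_closed)

text \<open>Sorting a sum by associativity and commutativity can leave \<open>y\<close> between
  \<open>x\<close> and its negative; \<open>group_simps\<close> needs to cancel across it.\<close>

lemma add_neg_cancel:
  assumes "x \<in> carrier A" "y \<in> carrier A"
  shows "x \<oplus> (y \<oplus> \<ominus> x) = y" "\<ominus> x \<oplus> (y \<oplus> x) = y"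
  using assms by (simp_all add: a_lcomm[of _ y] r_neg l_neg)

lemmas group_simps = a_minus_def minus_add minus_minus a_ac r_neg l_neg r_neg1 r_neg2
  add_neg_cancel

lemma diff_zero: "x \<in> carrier A \<Longrightarrow> x \<ominus> \<zero> = x"
  using minus_equality[of \<zero> \<zero>] by (simp add: a_minus_def)

lemma diff_chain:
  "x \<in> carrier A \<Longrightarrow> y \<in> carrier A \<Longrightarrow> z \<in> carrier A \<Longrightarrow> x \<ominus> z = (x \<ominus> y) \<oplus> (y \<ominus> z)"
  by (simp add: group_simps)

lemma add_diff_add:
  "a \<in> carrier A \<Longrightarrow> b \<in> carrier A \<Longrightarrow> c \<in> carrier A \<Longrightarrow> d \<in> carrier A
    \<Longrightarrow> (a \<oplus> b) \<ominus> (c \<oplus> d) = (a \<ominus> c) \<oplus> (b \<ominus> d)"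
  by (simp add: group_simps)

text \<open>The noncommutative product rule: continuity of multiplication and the contraction
  estimate for squares both rest on it.\<close>

lemma mult_diff_mult:
  assumes "a \<in> carrier A" "b \<in> carrier A" "c \<in> carrier A" "d \<in> carrier A"
  shows "a \<otimes> b \<ominus> c \<otimes> d = a \<otimes> (b \<ominus> d) \<oplus> (a \<ominus> c) \<otimes> d"
  using assms diff_chain[of "a \<otimes> b" "a \<otimes> d" "c \<otimes> d"]
  by (simp add: mult_diff_left mult_diff_right mult_closed)

text \<open>The relation \<open>b\<^sup>2 + c\<^sup>2 = 2c\<close> says \<open>b\<^sup>2 + (1 - c)\<^sup>2 = 1\<close>, so for \<open>k = \<plusminus>\<i>\<close> left
  multiplication by \<open>b + k (1 - c)\<close> is multiplication by a unitary of the unitisation.\<close>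

lemma unitary_left_mult:
  assumes "b \<in> carrier A" "c \<in> carrier A" "y \<in> carrier A"
    and "star A b = b" "star A c = c" and comm: "b \<otimes> c = c \<otimes> b"
    and rel: "b \<otimes> b \<oplus> c \<otimes> c = c \<oplus> c" and k: "cnj k = - k" "k * k = -1"
  defines "u \<equiv> b \<otimes> y \<oplus> k \<odot> (y \<ominus> c \<otimes> y)"
  shows "star A u \<otimes> u = star A y \<otimes> y"
proof -
  note [simp] = mult_closed star_closed assms(1-5)
  define w where "w = y \<ominus> c \<otimes> y"
  have w [simp]: "w \<in> carrier A" and u [simp]: "u \<in> carrier A"
    by (simp_all add: w_def u_def)
  have u_eq: "u = b \<otimes> y \<oplus> k \<odot> w"
    by (simp add: u_def w_def)
  \<comment> \<open>\<open>v\<close> is the formal adjoint \<open>b - k (1 - c)\<close> applied to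
    \<open>u\<close>. Moving the operator across the product leaves \<open>v = y\<close> to show,
    that is, that the adjoint inverts the operator.\<close>
  define v where "v = b \<otimes> u \<oplus> (- k) \<odot> (u \<ominus> c \<otimes> u)"
  have "star A u \<otimes> u = star A y \<otimes> v"
    by (simp add: u_def v_def minus_eq_smult star_add star_smult star_mult k
        distrib_left distrib_right smult_add_right smult_mult_left smult_mult_right mult_assoc
        smult_smult a_ac)
  moreover have "v = y"
  proof -
    have comm': "c \<otimes> (b \<otimes> y) = b \<otimes> (c \<otimes> y)"
      by (simp add: mult_assoc[symmetric] comm)
    have rel': "b \<otimes> (b \<otimes> y) \<oplus> c \<otimes> (c \<otimes> y) = c \<otimes> y \<oplus> c \<otimes> y"
      using arg_cong[OF rel, of "\<lambda>x. x \<otimes> y"] by (simp add: distrib_right mult_assoc)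
    have bu: "b \<otimes> u = b \<otimes> (b \<otimes> y) \<oplus> k \<odot> (b \<otimes> w)"
      by (simp add: u_eq distrib_left smult_mult_right)
    have cw: "u \<ominus> c \<otimes> u = (b \<otimes> y \<ominus> c \<otimes> (b \<otimes> y)) \<oplus> k \<odot> (w \<ominus> c \<otimes> w)"
      by (simp add: u_eq distrib_left smult_mult_right smult_minus add_diff_add)
    have bw: "b \<otimes> y \<ominus> c \<otimes> (b \<otimes> y) = b \<otimes> w"
      by (simp add: w_def mult_diff_right comm')
    have "(- k) \<odot> (u \<ominus> c \<otimes> u) = (-k) \<odot> (b \<otimes> w) \<oplus> (w \<ominus> c \<otimes> w)"
      by (simp add: cw bw smult_add_right smult_smult k)
    \<comment> \<open>The cross terms with factors \<open>k\<close> and \<open>- k\<close> cancel.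
      Since \<open>k * k = -1\<close>, what remains is \<open>b^2 y + (1 - c)^2 y\<close>, which the
      relation collapses to \<open>y\<close>.\<close>
    then have "v = (b \<otimes> (b \<otimes> y) \<oplus> (k \<odot> (b \<otimes> w) \<oplus> (-k) \<odot> (b \<otimes> w))) \<oplus> (w \<ominus> c \<otimes> w)"
      by (simp add: v_def bu a_assoc)
    also have "k \<odot> (b \<otimes> w) \<oplus> (-k) \<odot> (b \<otimes> w) = \<zero>"
      by (simp flip: smult_add_left)
    also have "w \<ominus> c \<otimes> w = (y \<ominus> (c \<otimes> y \<oplus> c \<otimes> y)) \<oplus> c \<otimes> (c \<otimes> y)"
      by (simp add: w_def mult_diff_right) (simp add: group_simps)
    also have "\<dots> = y \<ominus> b \<otimes> (b \<otimes> y)"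
      by (simp add: rel'[symmetric]) (simp add: group_simps)
    finally show ?thesis
      by (simp add: group_simps)
  qed
  ultimately show ?thesis by simp
qed

end

section \<open>Norms, limits and square roots in C*-algebras\<close>

context cstar_algebra
begin

lemma norm_nonneg [simp]: "x \<in> carrier A \<Longrightarrow> 0 \<le> cnorm A x"
  and norm_eq_0_iff: "x \<in> carrier A \<Longrightarrow> cnorm A x = 0 \<longleftrightarrow> x = \<zero>"
  and norm_smult: "x \<in> carrier A \<Longrightarrow> cnorm A (c \<odot> x) = cmod c * cnorm A x"
  and norm_add: "x \<in> carrier A \<Longrightarrow> y \<in> carrier A \<Longrightarrow> cnorm A (x \<oplus> y) \<le> cnorm A x + cnorm A y"
  and norm_mult_le: "x \<in> carrier A \<Longrightarrow> y \<in> carrier A \<Longrightarrow> cnorm A (x \<otimes> y) \<le> cnorm A x * cnorm A y"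
  and norm_star_mult: "x \<in> carrier A \<Longrightarrow> cnorm A (star A x \<otimes> x) = (cnorm A x)\<^sup>2"
  using cstar_norm unfolding cstar_norm_def by blast+

lemma norm_zero [simp]: "cnorm A \<zero> = 0"
  by (simp add: norm_eq_0_iff)

text \<open>Cancelling in \<parallel>y\<parallel>^2 = \<parallel>y* y\<parallel> \<le>
  \<parallel>y*\<parallel> \<parallel>y\<parallel> gives one inequality; the same for y* gives the
  other.\<close>

lemma norm_star [simp]: assumes "x \<in> carrier A" shows "cnorm A (star A x) = cnorm A x"
proof -
  have le: "cnorm A y \<le> cnorm A (star A y)" if y: "y \<in> carrier A" for y
  proof (cases "cnorm A y = 0")
    case False
    with norm_nonneg[OF y] have "cnorm A y > 0" by linarith
    moreover have "cnorm A y * cnorm A y \<le> cnorm A (star A y) * cnorm A y"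
      using norm_mult_le[of "star A y" y] y
      by (simp add: norm_star_mult star_closed power2_eq_square)
    ultimately show ?thesis by simp
  qed (simp add: y star_closed)
  from le[of x] le[of "star A x"] assms show ?thesis
    by (simp add: star_closed star_star)
qed

lemma norm_projection:
  assumes "projection A e" "e \<noteq> \<zero>"
  shows "cnorm A e = 1"
proof -
  have e: "e \<in> carrier A" "star A e \<otimes> e = e"
    using assms(1) by (auto simp: projection_def)
  then have "cnorm A e = cnorm A e * cnorm A e"
    using norm_star_mult[of e] by (simp add: power2_eq_square)
  then show ?thesis
    using e(1) assms(2) by (simp add: norm_eq_0_iff)
qed

lemma norm_minus_swap: "x \<in> carrier A \<Longrightarrow> y \<in> carrier A \<Longrightarrow> cnorm A (x \<ominus> y) = cnorm A (y \<ominus> x)"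
  using norm_smult[of "y \<ominus> x" "-1"]
  by (simp add: smult_minus) (simp add: a_inv_eq_smult[symmetric] group_simps)

lemma norm_triangle_diff:
  assumes "x \<in> carrier A" "y \<in> carrier A" "z \<in> carrier A"
  shows "cnorm A (x \<ominus> z) \<le> cnorm A (x \<ominus> y) + cnorm A (y \<ominus> z)"
  using assms norm_add[of "x \<ominus> y" "y \<ominus> z"] diff_chain[of x y z] by simp

text \<open>Carrier membership of the terms and of the limit is built in, which keeps side
  conditions out of the limit rules.\<close>

definition converges :: "(nat \<Rightarrow> 'a) \<Rightarrow> 'a \<Rightarrow> bool" where
  "converges X x \<longleftrightarrow> range X \<subseteq> carrier A \<and> x \<in> carrier A \<and> (\<lambda>n. cnorm A (X n \<ominus> x)) \<longlonglongrightarrow> 0"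

lemma convergesI:
  assumes "\<And>n. X n \<in> carrier A" "x \<in> carrier A" "\<And>n. cnorm A (X n \<ominus> x) \<le> e n" "e \<longlonglongrightarrow> 0"
  shows "converges X x"
proof -
  have "(\<lambda>n. cnorm A (X n \<ominus> x)) \<longlonglongrightarrow> 0"
    by (rule tendsto_sandwich[OF _ _ tendsto_const assms(4)]) (use assms in \<open>auto intro!: always_eventually\<close>)
  with assms show ?thesis by (auto simp: converges_def)
qed

lemma converges_carrier: "converges X x \<Longrightarrow> X n \<in> carrier A" "converges X x \<Longrightarrow> x \<in> carrier A"
  by (auto simp: converges_def)

lemma converges_const: "x \<in> carrier A \<Longrightarrow> converges (\<lambda>_. x) x"
  by (auto simp: converges_def group_simps)

lemma converges_unique:
  assumes "converges X x" "converges X y" shows "x = y"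
proof -
  note [simp] = assms[THEN converges_carrier(1)] assms[THEN converges_carrier(2)]
  have "(\<lambda>n. cnorm A (X n \<ominus> x) + cnorm A (X n \<ominus> y)) \<longlonglongrightarrow> 0 + 0"
    using assms by (intro tendsto_add) (auto simp: converges_def)
  moreover have "cnorm A (x \<ominus> y) \<le> cnorm A (X n \<ominus> x) + cnorm A (X n \<ominus> y)" for n
    using norm_triangle_diff[of x "X n" y] by (simp add: norm_minus_swap[of x "X n"])
  ultimately have "cnorm A (x \<ominus> y) \<le> 0"
    by (intro LIMSEQ_le_const[where X = "\<lambda>n. cnorm A (X n \<ominus> x) + cnorm A (X n \<ominus> y)"]) auto
  then have "cnorm A (x \<ominus> y) = 0"
    by (intro antisym) simp_all
  then have "x \<ominus> y = \<zero>"
    by (simp add: norm_eq_0_iff)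
  moreover have "x = (x \<ominus> y) \<oplus> y"
    by (simp add: group_simps)
  ultimately show ?thesis
    by simp
qed

lemma converges_add:
  assumes "converges X x" "converges Y y" shows "converges (\<lambda>n. X n \<oplus> Y n) (x \<oplus> y)"
proof -
  note [simp] = assms[THEN converges_carrier(1)] assms[THEN converges_carrier(2)]
  have "(\<lambda>n. cnorm A (X n \<ominus> x) + cnorm A (Y n \<ominus> y)) \<longlonglongrightarrow> 0 + 0"
    using assms by (intro tendsto_add) (auto simp: converges_def)
  then show ?thesis
    by (intro convergesI[where e = "\<lambda>n. cnorm A (X n \<ominus> x) + cnorm A (Y n \<ominus> y)"])
      (simp_all add: add_diff_add norm_add)
qed

lemma converges_mult:
  assumes "converges X x" "converges Y y" shows "converges (\<lambda>n. X n \<otimes> Y n) (x \<otimes> y)"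
proof -
  note [simp] = assms[THEN converges_carrier(1)] assms[THEN converges_carrier(2)] mult_closed
  define d e where "d n = cnorm A (X n \<ominus> x)" and "e n = cnorm A (Y n \<ominus> y)" for n
  have "d \<longlonglongrightarrow> 0" "e \<longlonglongrightarrow> 0"
    using assms by (simp_all add: converges_def d_def[abs_def] e_def[abs_def])
  then have "(\<lambda>n. (d n + cnorm A x) * e n + d n * cnorm A y) \<longlonglongrightarrow> (0 + cnorm A x) * 0 + 0 * cnorm A y"
    by (intro tendsto_intros)
  moreover have "cnorm A (X n \<otimes> Y n \<ominus> x \<otimes> y) \<le> (d n + cnorm A x) * e n + d n * cnorm A y" for n
  proof -
    \<comment> \<open>Bounding the moving factor by its limit plus an error gives an estimate whose
      limit can be read off.\<close>
    have X: "cnorm A (X n) \<le> d n + cnorm A x"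
      using norm_add[of "X n \<ominus> x" x] by (simp add: d_def group_simps)
    have "cnorm A (X n \<otimes> Y n \<ominus> x \<otimes> y) \<le> cnorm A (X n \<otimes> (Y n \<ominus> y)) + cnorm A ((X n \<ominus> x) \<otimes> y)"
      by (simp add: mult_diff_mult norm_add)
    also have "\<dots> \<le> cnorm A (X n) * e n + d n * cnorm A y"
      by (intro add_mono) (simp_all add: d_def e_def norm_mult_le)
    also have "\<dots> \<le> (d n + cnorm A x) * e n + d n * cnorm A y"
      using X by (intro add_mono mult_right_mono) (simp_all add: e_def)
    finally show ?thesis .
  qed
  ultimately show ?thesis
    by (intro convergesI[where e = "\<lambda>n. (d n + cnorm A x) * e n + d n * cnorm A y"]) simp_all
qed

lemma converges_star:
  assumes "converges X x" shows "converges (\<lambda>n. star A (X n)) (star A x)"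
  using assms by (auto simp: converges_def star_closed star_minus[symmetric] image_subset_iff)

lemma converges_Suc: "converges X x \<Longrightarrow> converges (\<lambda>n. X (Suc n)) x"
  by (auto simp: converges_def dest: LIMSEQ_Suc)

text \<open>\<open>c = 1 - (1 - h\<^sup>2)\<^bsup>1/2\<^esup>\<close> is the fixed point of \<open>c \<mapsto> (h\<^sup>2 + c\<^sup>2)/2\<close>, a contraction of the
  ball of radius \<open>\<parallel>h\<parallel>\<close>.\<close>

lemma ex_one_minus_sqrt:
  assumes h [simp]: "h \<in> carrier A" and sa: "star A h = h" and less: "cnorm A h < 1"
  shows "\<exists>c\<in>carrier A. star A c = c \<and> h \<otimes> c = c \<otimes> h \<and> h \<otimes> h \<oplus> c \<otimes> c = c \<oplus> c"
proof -
  note [simp] = mult_closed star_closed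
  define q where "q = cnorm A h"
  have q: "0 \<le> q" "q < 1" using less by (simp_all add: q_def)
  define T where "T c = (1/2) \<odot> (h \<otimes> h \<oplus> c \<otimes> c)" for c
  define X where "X n = (T ^^ n) \<zero>" for n
  have X0: "X 0 = \<zero>" and XS: "X (Suc n) = T (X n)" for n
    by (simp_all add: X_def)
  \<comment> \<open>Self-adjointness and commutation with \<open>h\<close> are carried along the
    iteration, next to the norm bound, so that they pass to the limit.\<close>
  have props: "X n \<in> carrier A \<and> cnorm A (X n) \<le> q \<and> star A (X n) = X n \<and> h \<otimes> X n = X n \<otimes> h" for n
  proof (induction n)
    case 0
    have "star A \<zero> = \<zero>" "h \<otimes> \<zero> = \<zero>" "\<zero> \<otimes> h = \<zero>"
      using star_smult[of h 0] smult_mult_right[of h h 0] smult_mult_left[of h h 0] by simp_all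
    then show ?case using q by (simp add: X0)
  next
    case (Suc n)
    then have [simp]: "X n \<in> carrier A" and le: "cnorm A (X n) \<le> q"
      and st: "star A (X n) = X n" and comm: "h \<otimes> X n = X n \<otimes> h" by auto
    have "cnorm A (h \<otimes> h) \<le> q * q" "cnorm A (X n \<otimes> X n) \<le> q * q"
      using norm_mult_le[of h h] norm_mult_le[of "X n" "X n"] le q
        mult_mono[OF le le] by (auto simp: q_def)
    then have "cnorm A (h \<otimes> h \<oplus> X n \<otimes> X n) \<le> 2 * (q * q)"
      using norm_add[of "h \<otimes> h" "X n \<otimes> X n"] by simp
    moreover have "q * q \<le> q"
      using q by (simp add: mult_left_le)
    ultimately have "cnorm A (T (X n)) \<le> q"
      by (simp add: T_def norm_smult)
    moreover have "star A (T (X n)) = T (X n)"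
      by (simp add: T_def star_smult star_add star_mult sa st)
    moreover have "h \<otimes> (X n \<otimes> X n) = X n \<otimes> (X n \<otimes> h)"
      by (simp add: mult_assoc[symmetric] comm) (simp add: mult_assoc comm)
    then have "h \<otimes> T (X n) = T (X n) \<otimes> h"
      by (simp add: T_def smult_mult_left smult_mult_right distrib_left distrib_right mult_assoc)
    ultimately show ?case by (simp add: XS T_def)
  qed
  then have [simp]: "X n \<in> carrier A" and le: "cnorm A (X n) \<le> q" for n by auto
  \<comment> \<open>Raising both indices by one applies \<open>T\<close> to both iterates: the
    \<open>h \<otimes> h\<close> parts cancel, and half the difference of the squares is at most
    \<open>q\<close> times the previous difference, as both iterates lie in the ball of radius
    \<open>q\<close>.\<close>
  have cauchy: "cnorm A (X (n + k) \<ominus> X n) \<le> q ^ n" for n k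
  proof (induction n)
    case 0
    show ?case using le[of k] q by (simp add: X0 diff_zero)
  next
    case (Suc n)
    define a b where "a = X (n + k)" and "b = X n"
    have [simp]: "a \<in> carrier A" "b \<in> carrier A" by (simp_all add: a_def b_def)
    have ab: "cnorm A a \<le> q" "cnorm A b \<le> q" "cnorm A (a \<ominus> b) \<le> q ^ n"
      using le Suc by (simp_all add: a_def b_def)
    have "X (Suc n + k) \<ominus> X (Suc n) = (1/2) \<odot> (a \<otimes> a \<ominus> b \<otimes> b)"
      by (simp add: XS T_def a_def b_def smult_minus[symmetric] add_diff_add)
        (simp add: a_minus_def r_neg)
    also have "cnorm A \<dots> = cnorm A (a \<otimes> a \<ominus> b \<otimes> b) / 2"
      by (simp add: norm_smult)
    also have "a \<otimes> a \<ominus> b \<otimes> b = a \<otimes> (a \<ominus> b) \<oplus> (a \<ominus> b) \<otimes> b"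
      by (simp add: mult_diff_mult)
    also have "cnorm A \<dots> \<le> cnorm A a * cnorm A (a \<ominus> b) + cnorm A (a \<ominus> b) * cnorm A b"
      by (rule order_trans[OF norm_add]) (auto intro!: add_mono norm_mult_le)
    also have "\<dots> \<le> q * q ^ n + q ^ n * q"
      using ab q by (intro add_mono mult_mono) auto
    finally show ?case by simp
  qed
  have "\<exists>c\<in>carrier A. (\<lambda>n. cnorm A (X n \<ominus> c)) \<longlonglongrightarrow> 0"
  proof (rule complete)
    fix e :: real assume "e > 0"
    have "(\<lambda>n. q ^ n) \<longlonglongrightarrow> 0" using q by (intro LIMSEQ_power_zero) simp
    with \<open>e > 0\<close> obtain N where N: "\<And>n. n \<ge> N \<Longrightarrow> q ^ n < e"
      using order_tendstoD(2)[of "\<lambda>n. q ^ n" 0 sequentially e] by (auto simp: eventually_sequentially)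
    have *: "cnorm A (X m \<ominus> X n) < e" if "N \<le> n" "n \<le> m" for m n
      using cauchy[of n "m - n"] N[of n] that by simp
    have "cnorm A (X m \<ominus> X n) < e" if "N \<le> n" "N \<le> m" for m n
      using *[of n m] *[of m n] that by (cases "n \<le> m") (auto simp: norm_minus_swap[of "X m"])
    then show "\<exists>N. \<forall>m\<ge>N. \<forall>n\<ge>N. cnorm A (X m \<ominus> X n) < e" by blast
  qed simp
  moreover have "range X \<subseteq> carrier A" by auto
  ultimately obtain c where c: "converges X c"
    unfolding converges_def by blast
  have [simp]: "c \<in> carrier A" using c by (rule converges_carrier(2))
  have "star A c = c"
    using converges_unique[OF converges_star[OF c]] c props by simp
  moreover have "h \<otimes> c = c \<otimes> h"
    using converges_unique[OF converges_mult[OF converges_const[OF h] c]]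
      converges_mult[OF c converges_const[OF h]] props by simp
  moreover have "h \<otimes> h \<oplus> c \<otimes> c = c \<oplus> c"
  proof -
    \<comment> \<open>The recursion, doubled: both sides converge, so uniqueness of limits turns it
      into the fixed-point equation.\<close>
    have "X (Suc n) \<oplus> X (Suc n) = h \<otimes> h \<oplus> X n \<otimes> X n" for n
      by (simp add: XS T_def flip: smult_add_left)
    then show ?thesis
      using converges_unique[OF converges_add[OF converges_const[of "h \<otimes> h"] converges_mult[OF c c]]]
        converges_add[OF converges_Suc[OF c] converges_Suc[OF c]] by simp
  qed
  ultimately show ?thesis by auto
qed

text \<open>Left multiplication by the formal unitaries \<open>b + k (1 - c)\<close>, for k =
  \<plusminus>\<i>, preserves the norm of \<open>b\<close>, and the two images add up to
  \<open>2 b^2\<close>. Hence \<parallel>b^2\<parallel> \<le> \<parallel>b\<parallel>, and the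
  C*-identity for self-adjoint \<open>b\<close> finishes.\<close>

lemma norm_le_1_if_quadratic_relation:
  assumes "b \<in> carrier A" "c \<in> carrier A" "star A b = b" "star A c = c" "b \<otimes> c = c \<otimes> b"
    and "b \<otimes> b \<oplus> c \<otimes> c = c \<oplus> c"
  shows "cnorm A b \<le> 1"
proof -
  note [simp] = assms(1,2) mult_closed star_closed
  define u where "u k = b \<otimes> b \<oplus> k \<odot> (b \<ominus> c \<otimes> b)" for k
  have [simp]: "u k \<in> carrier A" for k by (simp add: u_def)
  have norm_u: "cnorm A (u k) = cnorm A b" if "cnj k = - k" "k * k = -1" for k
  proof -
    have "(cnorm A (u k))\<^sup>2 = (cnorm A b)\<^sup>2"
      using unitary_left_mult[of b c b k] assms that
      by (simp add: u_def flip: norm_star_mult)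
    then show ?thesis by simp
  qed
  have "2 \<odot> (b \<otimes> b) = u \<i> \<oplus> u (- \<i>)"
  proof -
    define w where "w = b \<ominus> c \<otimes> b"
    have [simp]: "w \<in> carrier A" by (simp add: w_def)
    have "u \<i> \<oplus> u (- \<i>) = (b \<otimes> b \<oplus> b \<otimes> b) \<oplus> (\<i> \<odot> w \<oplus> (- \<i>) \<odot> w)"
      unfolding u_def w_def[symmetric] by (simp add: a_ac)
    also have "\<i> \<odot> w \<oplus> (- \<i>) \<odot> w = \<zero>" by (simp flip: smult_add_left)
    also have "b \<otimes> b \<oplus> b \<otimes> b = 2 \<odot> (b \<otimes> b)"
      using smult_add_left[of "b \<otimes> b" 1 1] by simp
    finally show ?thesis by simp
  qed
  then have "2 * cnorm A (b \<otimes> b) \<le> cnorm A (u \<i>) + cnorm A (u (- \<i>))"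
    using norm_smult[of "b \<otimes> b" 2] norm_add[of "u \<i>" "u (-\<i>)"] by simp
  then have "cnorm A b * cnorm A b \<le> cnorm A b"
    using norm_star_mult[of b] assms(3) by (simp add: norm_u power2_eq_square)
  then show ?thesis
    using norm_nonneg[of b] by (cases "cnorm A b = 0") (auto simp: mult_le_cancel_left2)
qed

end

section \<open>Contractivity of *-homomorphisms, and pulling back functionals and states\<close>

text \<open>The relation between \<open>h\<close> and \<open>c\<close> is purely algebraic, so it
  survives \<open>f\<close> and bounds \<open>f h\<close>. Rescaling then reaches all self-adjoint
  elements, and the C*-identity all elements.\<close>

lemma star_hom_norm_le:
  assumes "cstar_algebra A" "cstar_algebra B" "star_hom A B f" "x \<in> carrier A"
  shows "cnorm B (f x) \<le> cnorm A x"
proof -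
  interpret A: cstar_algebra A by fact
  interpret B: cstar_algebra B by fact
  have f_closed [simp]: "x \<in> carrier A \<Longrightarrow> f x \<in> carrier B" for x
    using assms(3) by (auto simp: star_hom_def)
  have f_add: "\<lbrakk>x \<in> carrier A; y \<in> carrier A\<rbrakk> \<Longrightarrow> f (x \<oplus>\<^bsub>A\<^esub> y) = f x \<oplus>\<^bsub>B\<^esub> f y"
    and f_smult: "x \<in> carrier A \<Longrightarrow> f (c \<odot>\<^bsub>A\<^esub> x) = c \<odot>\<^bsub>B\<^esub> f x"
    and f_mult: "\<lbrakk>x \<in> carrier A; y \<in> carrier A\<rbrakk> \<Longrightarrow> f (x \<otimes>\<^bsub>A\<^esub> y) = f x \<otimes>\<^bsub>B\<^esub> f y"
    and f_star: "x \<in> carrier A \<Longrightarrow> f (star A x) = star B (f x)" for x y c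
    using assms(3) by (auto simp: star_hom_def)
  have unit_ball: "cnorm B (f h) \<le> 1"
    if h: "h \<in> carrier A" "star A h = h" "cnorm A h < 1" for h
  proof -
    obtain c where c: "c \<in> carrier A" "star A c = c" "h \<otimes>\<^bsub>A\<^esub> c = c \<otimes>\<^bsub>A\<^esub> h"
      "h \<otimes>\<^bsub>A\<^esub> h \<oplus>\<^bsub>A\<^esub> c \<otimes>\<^bsub>A\<^esub> c = c \<oplus>\<^bsub>A\<^esub> c"
      using A.ex_one_minus_sqrt[OF h] by blast
    note [simp] = c(1) h(1) A.mult_closed
    show ?thesis
      using arg_cong[OF c(2), of f] arg_cong[OF c(3), of f] arg_cong[OF c(4), of f]
        arg_cong[OF h(2), of f]
      by (intro B.norm_le_1_if_quadratic_relation[of "f h" "f c"])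
        (simp_all add: f_add f_mult f_star)
  qed
  have self_adjoint: "cnorm B (f h) \<le> cnorm A h" if h: "h \<in> carrier A" "star A h = h" for h
  proof (rule dense_ge)
    \<comment> \<open>Dividing by some \<open>t\<close> strictly above the norm, instead of the norm
      itself, puts \<open>h\<close> into the open unit ball and covers \<open>h = 0\<close> as
      well.\<close>
    fix t assume t: "cnorm A h < t"
    then have "t > 0" using A.norm_nonneg[OF h(1)] by linarith
    then have "cnorm B (f (of_real (1 / t) \<odot>\<^bsub>A\<^esub> h)) \<le> 1"
      using h t by (intro unit_ball) (simp_all add: A.star_smult A.norm_smult norm_divide)
    with \<open>t > 0\<close> show "cnorm B (f h) \<le> t"
      using h by (simp add: f_smult B.norm_smult norm_divide)
  qed
  have "(cnorm B (f x))\<^sup>2 = cnorm B (f (star A x \<otimes>\<^bsub>A\<^esub> x))"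
    using assms(4) by (simp add: f_mult f_star A.star_closed B.norm_star_mult)
  also have "\<dots> \<le> cnorm A (star A x \<otimes>\<^bsub>A\<^esub> x)"
    using assms(4) by (intro self_adjoint)
      (simp_all add: A.mult_closed A.star_closed A.star_mult A.star_star)
  also have "\<dots> = (cnorm A x)\<^sup>2"
    using assms(4) by (rule A.norm_star_mult)
  finally show ?thesis
    by (rule power2_le_imp_le) (simp add: assms(4))
qed

lemma bounded_functional_comp:
  assumes "cstar_algebra A" "cstar_algebra B" "star_hom A B f" "bounded_functional B F"
  shows "bounded_functional A (F \<circ> f)"
proof -
  obtain K where K: "\<And>y. y \<in> carrier B \<Longrightarrow> cmod (F y) \<le> K * cnorm B y"
    using assms(4) unfolding bounded_functional_def by blast
  have f: "f x \<in> carrier B" if "x \<in> carrier A" for x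
    using assms(3) that by (auto simp: star_hom_def)
  interpret B: cstar_algebra B by fact
  \<comment> \<open>The sign of \<open>K\<close> is not known; its absolute value makes
    multiplication by it monotone.\<close>
  have "cmod (F (f x)) \<le> \<bar>K\<bar> * cnorm A x" if x: "x \<in> carrier A" for x
  proof -
    have "cmod (F (f x)) \<le> \<bar>K\<bar> * cnorm B (f x)"
      by (rule order_trans[OF K]) (use f[OF x] in \<open>auto intro: mult_right_mono\<close>)
    also have "\<dots> \<le> \<bar>K\<bar> * cnorm A x"
      using star_hom_norm_le[OF assms(1-3) x] by (intro mult_left_mono) auto
    finally show ?thesis .
  qed
  then have "\<exists>K. \<forall>x\<in>carrier A. cmod (F (f x)) \<le> K * cnorm A x"
    by blast
  with assms(3,4) f show ?thesis
    by (simp add: bounded_functional_def star_hom_def)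
qed

text \<open>Boundedness of \<open>\<phi>\<close> makes its values on the unit ball bounded above, so
  that the supremum in \<open>functional_norm\<close> really is an upper bound.\<close>

lemma state_cmod_le_1:
  assumes "cstar_algebra A" "state A \<phi>" "x \<in> carrier A" "cnorm A x \<le> 1"
  shows "cmod (\<phi> x) \<le> 1"
proof -
  interpret cstar_algebra A by fact
  obtain K where K: "\<And>y. y \<in> carrier A \<Longrightarrow> cmod (\<phi> y) \<le> K * cnorm A y"
    using assms(2) unfolding state_def bounded_functional_def by blast
  have "cmod (\<phi> y) \<le> \<bar>K\<bar>" if y: "y \<in> carrier A" "cnorm A y \<le> 1" for y
  proof -
    have "cmod (\<phi> y) \<le> \<bar>K\<bar> * cnorm A y"
      by (rule order_trans[OF K]) (use y in \<open>auto intro: mult_right_mono\<close>)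
    also have "\<dots> \<le> \<bar>K\<bar>"
      using y by (simp add: mult_left_le)
    finally show ?thesis .
  qed
  then have "bdd_above ((\<lambda>x. cmod (\<phi> x)) ` {x \<in> carrier A. cnorm A x \<le> 1})"
    by (auto intro!: bdd_aboveI2)
  then have "cmod (\<phi> x) \<le> functional_norm A \<phi>"
    unfolding functional_norm_def using assms(3,4) by (intro cSUP_upper) auto
  with assms(2) show ?thesis
    by (simp add: state_def)
qed

text \<open>Positivity and boundedness pull back along any *-homomorphism. Contractivity keeps the
  norm at most 1, and \<open>e\<close> keeps it from dropping below 1.\<close>

lemma state_comp:
  assumes A: "cstar_algebra A" and B: "cstar_algebra B" and f: "star_hom A B f"
    and \<phi>: "state B \<phi>" and e: "e \<in> carrier A" "cnorm A e \<le> 1" "\<phi> (f e) = 1"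
  shows "state A (\<phi> \<circ> f)"
proof -
  have f_closed: "f x \<in> carrier B" if "x \<in> carrier A" for x
    using f that by (auto simp: star_hom_def)
  have "functional_norm A (\<phi> \<circ> f) = 1"
    unfolding functional_norm_def
  proof (rule cSup_eq_maximum)
    show "1 \<in> (\<lambda>x. cmod ((\<phi> \<circ> f) x)) ` {x \<in> carrier A. cnorm A x \<le> 1}"
      using e by (intro image_eqI[of _ _ e]) auto
  next
    fix r assume "r \<in> (\<lambda>x. cmod ((\<phi> \<circ> f) x)) ` {x \<in> carrier A. cnorm A x \<le> 1}"
    then obtain x where x: "x \<in> carrier A" "cnorm A x \<le> 1" "r = cmod (\<phi> (f x))"
      by auto
    with star_hom_norm_le[OF A B f] have "cnorm B (f x) \<le> 1"
      by fastforce
    with state_cmod_le_1[OF B \<phi> f_closed] x show "r \<le> 1"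
      by simp
  qed
  moreover have "\<phi> (f (star A x \<otimes>\<^bsub>A\<^esub> x)) \<in> \<real> \<and> 0 \<le> Re (\<phi> (f (star A x \<otimes>\<^bsub>A\<^esub> x)))"
    if x: "x \<in> carrier A" for x
  proof -
    interpret A: cstar_algebra A by fact
    have "f (star A x \<otimes>\<^bsub>A\<^esub> x) = star B (f x) \<otimes>\<^bsub>B\<^esub> f x"
      using f x A.star_closed[OF x] by (simp add: star_hom_def)
    with \<phi> f_closed[OF x] show ?thesis
      by (simp add: state_def)
  qed
  ultimately show ?thesis
    using bounded_functional_comp[OF A B f] \<phi> by (simp add: state_def)
qed

section \<open>Connecting maps into three-point partitions\<close>

context
  fixes s t u :: real
  assumes less: "s < t" "t < u"
begin

text \<open>Both outer parts are single points and contribute no factor, and at cardinality 3 the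
  recursion of \<open>delta_block\<close> ends in the co-multiplication.\<close>

lemma delta_times_refine: "delta_times S p {s,u} {s,t,u} x = comult S s t u x"
proof -
  have [simp]: "{s,t,u} \<inter> {..s} = {s}" "{s,t,u} \<inter> {s..u} = {s,t,u}" "{s,t,u} \<inter> {u..} = {u}"
    using less by auto
  have [simp]: "{s, t, u} - {u} = {s, t}" "card {s,t,u} = 3" "card {s,u} = 2"
    using less by auto
  show ?thesis
    using less by (simp add: delta_times_def delta.simps delta_block.simps Let_def)
qed

text \<open>The middle part is \<open>{s,t}\<close> itself, where the block map is the identity;
  only the unit over \<open>{t,u}\<close> is appended.\<close>

lemma delta_times_extend_right:
  "delta_times S p {s,t} {s,t,u} x = tens S {s,t} {t,u} x (p t u)"
proof -
  have [simp]: "{s,t,u} \<inter> {..s} = {s}" "{s,t,u} \<inter> {s..t} = {s,t}" "{s,t,u} \<inter> {t..} = {t,u}" "{s,t,s} = {s,t}"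
    using less by auto
  have [simp]: "card {s,t} = 2" "card {t,u} = 2"
    using less by auto
  show ?thesis
    using less
    by (simp add: delta_times_def delta.simps delta_block.simps unit_tensor.simps Let_def)
qed

lemma delta_times_extend_left:
  "delta_times S p {t,u} {s,t,u} x = tens S {s,t} {t,u} (p s t) x"
proof -
  have [simp]: "{s,t,u} \<inter> {..t} = {s,t}" "{s,t,u} \<inter> {t..u} = {t,u}" "{s,t,u} \<inter> {u..} = {u}"
    using less by auto
  have [simp]: "card {s,t} = 2" "card {t,u} = 2"
    using less by auto
  show ?thesis
    using less
    by (simp add: delta_times_def delta.simps delta_block.simps unit_tensor.simps Let_def)
qed

end

section \<open>The image of the unit in the inductive limit\<close>

lemma interval_in_parts: "0 < s \<Longrightarrow> s < t \<Longrightarrow> {s,t} \<in> parts"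
  "0 < s \<Longrightarrow> s < t \<Longrightarrow> t < u \<Longrightarrow> {s,t,u} \<in> parts"
  by (auto simp: parts_def)

lemma interval_in_parts_of: "0 < s \<Longrightarrow> s < t \<Longrightarrow> {s,t} \<in> parts_of s t"
  using interval_in_parts(1)[of s t] by (simp add: parts_of_def)

text \<open>Extending \<open>p s t\<close> or \<open>p t u\<close> appends the other one, while the
  unit equation splits \<open>p s u\<close>: all three reach the same elementary tensor over
  \<open>{s,t,u}\<close>, and the embeddings respect the connecting maps.\<close>

lemma limit_unit_eq:
  assumes unit: "subproduct_unit S p" and lim: "subproduct_limit S p C D"
    and ord: "0 < s" "s < t" "t < u"
  shows "D {s,t} (p s t) = D {s,t,u} (tens S {s,t} {t,u} (p s t) (p t u))"
    and "D {t,u} (p t u) = D {s,t,u} (tens S {s,t} {t,u} (p s t) (p t u))"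
    and "D {s,u} (p s u) = D {s,t,u} (tens S {s,t} {t,u} (p s t) (p t u))"
proof -
  have p: "p s t \<in> carrier (alg S {s,t})" if "0 < s" "s < t" for s t
    using unit that by (simp add: subproduct_unit_def projection_def)
  have D: "D J (delta_times S p I J x) = D I x"
    if "I \<in> parts" "J \<in> parts" "I \<subseteq> J" "x \<in> carrier (alg S I)" for I J x
    using lim that by (simp add: subproduct_limit_def cstar_inductive_limit_def)
  note parts = interval_in_parts
  show "D {s,t} (p s t) = D {s,t,u} (tens S {s,t} {t,u} (p s t) (p t u))"
    using ord p[of s t] D[of "{s,t}" "{s,t,u}" "p s t"]
    by (simp add: parts delta_times_extend_right)
  show "D {t,u} (p t u) = D {s,t,u} (tens S {s,t} {t,u} (p s t) (p t u))"
    using ord p[of t u] D[of "{t,u}" "{s,t,u}" "p t u"]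
    by (simp add: parts delta_times_extend_left)
  have "comult S s t u (p s u) = tens S {s,t} {t,u} (p s t) (p t u)"
    using unit ord by (simp add: subproduct_unit_def)
  then show "D {s,u} (p s u) = D {s,t,u} (tens S {s,t} {t,u} (p s t) (p t u))"
    using ord p[of s u] D[of "{s,u}" "{s,t,u}" "p s u"]
    by (simp add: parts delta_times_refine)
qed

lemma limit_unit_const:
  assumes "subproduct_unit S p" "subproduct_limit S p C D" "0 < s" "s < t" "0 < s'" "s' < t'"
  shows "D {s,t} (p s t) = D {s',t'} (p s' t')"
proof -
  note eq = limit_unit_eq[OF assms(1,2)]
  \<comment> \<open>A common right end point; the added 1 makes it strictly larger than both. Each
    interval is prolonged to \<open>u\<close>, and the prolonged ones are compared through their
    left end points.\<close>
  define u where "u = max t t' + 1"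
  have u: "t < u" "t' < u" "s < u" "s' < u"
    using assms by (auto simp: u_def)
  have "D {s,u} (p s u) = D {s',u} (p s' u)"
    using eq[of s s' u] eq[of s' s u] assms(3,5) u by (cases s s' rule: linorder_cases) auto
  with eq[of s t u] eq[of s' t' u] assms u show ?thesis
    by simp
qed

text \<open>Constancy over all intervals justifies the definite description in
  \<open>limit_projection\<close>.\<close>

lemma limit_projection_eq:
  assumes "subproduct_unit S p" "subproduct_limit S p C D" "0 < s" "s < t"
  shows "limit_projection p D = D {s,t} (p s t)"
  unfolding limit_projection_def
proof (rule the_equality)
  show "\<forall>s' t'. 0 < s' \<and> s' < t' \<longrightarrow> D {s',t'} (p s' t') = D {s,t} (p s t)"
    using limit_unit_const[OF assms(1,2) _ _ assms(3,4)] by blast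
qed (use assms(3,4) in blast)

section \<open>Marginals of an idempotent state\<close>

theorem proposition6p2:
  fixes S :: "'a subproduct"
    and p :: "real \<Rightarrow> real \<Rightarrow> 'a"
    and C :: "'b cstar" and D :: "real set \<Rightarrow> 'a \<Rightarrow> 'b"
    and CC :: "'c cstar" and \<tau> :: "'b \<Rightarrow> 'b \<Rightarrow> 'c"
    and \<Delta> :: "real \<Rightarrow> 'b \<Rightarrow> 'c"
    and \<phi> :: "'b \<Rightarrow> complex"
  assumes "cstar_subproduct_system S"
    and "subproduct_unit S p"
    and "subproduct_limit S p C D"
    and "min_tensor C C CC \<tau>"
    and "comultiplication S C D CC \<tau> \<Delta>"
    and "idempotent_state p C D CC \<tau> \<Delta> \<phi>"
  shows "co_unital S \<and> subproduct_counit S (\<lambda>s t. \<phi> \<circ> D {s,t})"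
proof -
  have C: "cstar_algebra C" and CC: "cstar_algebra CC"
    using assms(4) by (auto simp: min_tensor_def)
  have A: "cstar_algebra (alg S {s,t})" if "0 < s" "s < t" for s t
    using assms(1) that by (simp add: cstar_subproduct_system_def)
  have D: "star_hom (alg S I) C (D I)" if "I \<in> parts" for I
    using assms(3) that by (simp add: subproduct_limit_def cstar_inductive_limit_def star_mono_def)
  have D_closed: "D I x \<in> carrier C" if "I \<in> parts" "x \<in> carrier (alg S I)" for I x
    using D[OF that(1)] that(2) by (auto simp: star_hom_def)
  have state: "state C \<phi>"
    using assms(6) by (simp add: idempotent_state_def)
  obtain F where F: "is_tensor_functional C C CC \<tau> \<phi> \<phi> F"
    and F_\<Delta>: "\<And>s x. s > 0 \<Longrightarrow> x \<in> carrier C \<Longrightarrow> F (\<Delta> s x) = \<phi> x"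
    using assms(6) by (auto simp: idempotent_state_def)
  have p: "projection (alg S {s,t}) (p s t)" "p s t \<noteq> \<zero>\<^bsub>alg S {s,t}\<^esub>" "p s t \<in> carrier (alg S {s,t})"
    if "0 < s" "s < t" for s t
    using assms(2) that by (auto simp: subproduct_unit_def projection_def)
  have alg3: "cstar_algebra (alg S {r,s,t})"
    and tens_closed: "\<And>a b. a \<in> carrier (alg S {r,s}) \<Longrightarrow> b \<in> carrier (alg S {s,t})
      \<Longrightarrow> tens S {r,s} {s,t} a b \<in> carrier (alg S {r,s,t})"
    if "0 < r" "r < s" "s < t" for r s t
  proof -
    have "\<forall>I\<in>parts. \<forall>J\<in>parts. Max I = Min J \<longrightarrow>
        min_tensor (alg S I) (alg S J) (alg S (I \<union> J)) (tens S I J)"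
      using assms(1) by (simp add: cstar_subproduct_system_def tensor_family_def)
    moreover have "{r,s} \<in> parts" "{s,t} \<in> parts" "Max {r,s} = Min {s,t}" "{r,s} \<union> {s,t} = {r,s,t}"
      using that by (auto simp: interval_in_parts)
    ultimately have "min_tensor (alg S {r,s}) (alg S {s,t}) (alg S {r,s,t}) (tens S {r,s} {s,t})"
      by metis
    then show "cstar_algebra (alg S {r,s,t})"
      "\<And>a b. a \<in> carrier (alg S {r,s}) \<Longrightarrow> b \<in> carrier (alg S {s,t})
        \<Longrightarrow> tens S {r,s} {s,t} a b \<in> carrier (alg S {r,s,t})"
      by (auto simp: min_tensor_def)
  qed
  have \<Delta>: "star_hom (alg S {r,s,t}) CC (\<Delta> s \<circ> D {r,s,t})"
    and \<Delta>_tens: "\<And>a b. a \<in> carrier (alg S {r,s}) \<Longrightarrow> b \<in> carrier (alg S {s,t})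
      \<Longrightarrow> \<Delta> s (D {r,s,t} (tens S {r,s} {s,t} a b)) = \<tau> (D {r,s} a) (D {s,t} b)"
    if ord: "0 < r" "r < s" "s < t" for r s t
  proof -
    have "is_tensor_hom (alg S {r,s}) (alg S {s,t}) (alg S ({r,s} \<union> {s,t})) (tens S {r,s} {s,t})
        CC \<tau> (D {r,s}) (D {s,t}) (\<Delta> s \<circ> D ({r,s} \<union> {s,t}))"
      using assms(5) ord interval_in_parts_of[of r s] interval_in_parts_of[of s t]
      unfolding comultiplication_def by (meson order.strict_trans)
    moreover have "{r,s} \<union> {s,t} = {r,s,t}"
      by auto
    ultimately show "star_hom (alg S {r,s,t}) CC (\<Delta> s \<circ> D {r,s,t})"
      "\<And>a b. a \<in> carrier (alg S {r,s}) \<Longrightarrow> b \<in> carrier (alg S {s,t})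
      \<Longrightarrow> \<Delta> s (D {r,s,t} (tens S {r,s} {s,t} a b)) = \<tau> (D {r,s} a) (D {s,t} b)"
      by (auto simp: is_tensor_hom_def)
  qed
  have F_\<tau>: "F (\<tau> x y) = \<phi> x * \<phi> y" if "x \<in> carrier C" "y \<in> carrier C" for x y
    using F that by (simp add: is_tensor_functional_def)
  \<comment> \<open>Over a partition cut at \<open>s\<close>, \<open>\<Delta> s\<close> acts as the
    tensor product of the two embeddings, so idempotency makes \<open>\<phi>\<close> multiplicative
    across the cut.\<close>
  have \<phi>_tens: "\<phi> (D {r,s,t} (tens S {r,s} {s,t} a b)) = \<phi> (D {r,s} a) * \<phi> (D {s,t} b)"
    if ord: "0 < r" "r < s" "s < t" and ab: "a \<in> carrier (alg S {r,s})" "b \<in> carrier (alg S {s,t})"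
    for r s t a b
    using \<Delta>_tens[OF that] F_\<Delta>[of s "D {r,s,t} (tens S {r,s} {s,t} a b)"]
      F_\<tau>[of "D {r,s} a" "D {s,t} b"] ord ab tens_closed[OF that]
    by (simp add: D_closed interval_in_parts)
  have \<phi>_p: "\<phi> (D {s,t} (p s t)) = 1" if "0 < s" "s < t" for s t
  proof -
    define e where "e = limit_projection p D"
    have e: "D {s,t} (p s t) = e" if "0 < s" "s < t" for s t
      using limit_projection_eq[OF assms(2,3) that] by (simp add: e_def)
    \<comment> \<open>Any cut would do. For 1, 2, 3 the elements \<open>p 1 2\<close>,
      \<open>p 2 3\<close> and their tensor all embed as \<open>e\<close>.\<close>
    have "\<phi> e = \<phi> e * \<phi> e"
      using \<phi>_tens[of 1 2 3 "p 1 2" "p 2 3"] limit_unit_eq(1)[OF assms(2,3), of 1 2 3] p(3)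
      by (simp add: e)
    moreover have "e \<in> carrier C" and "star C e \<otimes>\<^bsub>C\<^esub> e = e"
      using D[of "{1,2}"] p(1,3)[of 1 2] e[of 1 2]
      by (auto simp: interval_in_parts star_hom_def projection_def) metis+
    \<comment> \<open>Since e* e = e, lying outside the left kernel says that
      \<open>\<phi> e\<close> is non-zero, which excludes the other root of x = x^2.\<close>
    then have "\<phi> e \<noteq> 0"
      using assms(6) by (simp add: idempotent_state_def left_kernel_def flip: e_def)
    ultimately show ?thesis
      using e[OF that] by simp
  qed
  have "subproduct_counit S (\<lambda>s t. \<phi> \<circ> D {s,t})"
    unfolding subproduct_counit_def
  proof (intro conjI allI impI; elim conjE)
    fix s t :: real assume ord: "0 < s" "s < t"
    then interpret cstar_algebra "alg S {s,t}" by (rule A)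
    \<comment> \<open>The norm-attaining element is \<open>p s t\<close>: as a non-zero projection
      it has norm 1, and the marginal takes the value 1 there.\<close>
    show "state (alg S {s,t}) (\<phi> \<circ> D {s,t})"
      using state_comp[OF A[OF ord] C D[OF interval_in_parts(1)[OF ord]] state p(3)[OF ord]]
        norm_projection[OF p(1,2)[OF ord]] \<phi>_p[OF ord] by simp
  next
    fix r s t :: real assume ord: "0 < r" "r < s" "s < t"
    have U: "{r,s} \<union> {s,t} = {r,s,t}" by auto
    \<comment> \<open>The tensor product of the two marginals is obtained by restricting
      \<open>F\<close> along \<open>\<Delta> s\<close> and the embedding of the three-point algebra;
      contractivity of this *-homomorphism makes it bounded.\<close>
    let ?G = "F \<circ> (\<Delta> s \<circ> D {r,s,t})"
    have "bounded_functional (alg S {r,s,t}) ?G"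
      using bounded_functional_comp[OF alg3[OF ord] CC \<Delta>[OF ord]] F
      by (simp add: is_tensor_functional_def)
    moreover have "?G (tens S {r,s} {s,t} a b) = \<phi> (D {r,s} a) * \<phi> (D {s,t} b)"
      if "a \<in> carrier (alg S {r,s})" "b \<in> carrier (alg S {s,t})" for a b
      using that ord \<Delta>_tens[OF ord that] by (simp add: F_\<tau> D_closed interval_in_parts)
    moreover have "\<phi> (D {r,t} x) = ?G (comult S r s t x)" if x: "x \<in> carrier (alg S {r,t})" for x
    proof -
      have "star_mono (alg S {r,t}) (alg S {r,s,t}) (comult S r s t)"
        using assms(1) ord unfolding cstar_subproduct_system_def by (metis U)
      then have "comult S r s t x \<in> carrier (alg S {r,s,t})"
        using x by (auto simp: star_mono_def star_hom_def)
      moreover have "D {r,t} x \<in> carrier C"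
        using ord x by (intro D_closed interval_in_parts(1)) auto
      \<comment> \<open>Refining \<open>{r,t}\<close> by \<open>s\<close> is the co-multiplication,
        and the embeddings absorb it, so \<open>?G\<close> after \<open>comult S r s t\<close> is
        \<open>F\<close> after \<open>\<Delta> s\<close> on the image of \<open>x\<close>.\<close>
      moreover have "D {r,s,t} (delta_times S p {r,t} {r,s,t} x) = D {r,t} x"
        using assms(3) x ord
        by (simp add: subproduct_limit_def cstar_inductive_limit_def interval_in_parts)
      ultimately show ?thesis
        using ord by (simp add: F_\<Delta> delta_times_refine)
    qed
    ultimately show "\<exists>F. is_tensor_functional (alg S {r,s}) (alg S {s,t}) (alg S ({r,s} \<union> {s,t}))
        (tens S {r,s} {s,t}) (\<phi> \<circ> D {r,s}) (\<phi> \<circ> D {s,t}) F \<and>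
      (\<forall>x\<in>carrier (alg S {r,t}). (\<phi> \<circ> D {r,t}) x = F (comult S r s t x))"
      unfolding U by (intro exI[of _ ?G]) (simp add: is_tensor_functional_def)
  qed
  then show ?thesis
    by (auto simp: co_unital_def)
qed

end
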